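(* Let $d\ge 1$ be an integer and let $\mathcal{F}$ be the barycentric subdivision of $(d-1)$-dimensional simplicial complexes. Then its transformation matrix $H_{\mathcal F}$ has the bidiagonal decomposition $$H_{\mathcal F}=W_0W_1\cdots W_{d-1}W_d\cdots W_{2d-1},$$ where the $(d+1)\times(d+1)$ matrices $W_0,\dots,W_{2d-1}$ (rows and columns indexed by $0,\dots,d$) are as follows. (1) For $i=0,1,\dots,d-1$, $W_i$ is lower bidiagonal with - diagonal entries $W_i(m,m)=m+1$ for $0\le m\le d-i-1$ and $W_i(m,m)=1$ for $d-i\le m\le d$; - subdiagonal entries $W_i(m,m-1)=d-i-m$ for $1\le m\le d-i-1$ and $W_i(m,m-1)=0$ for $d-i\le m\le d$; - all other entries $0$. (2) For $j=0,1,\dots,d-1$, $W_{d+j}$ is upper bidiagonal with - diagonal entries $W_{d+j}(m,m)=1$ for $0\le m\le d$; - superdiagonal entries $W_{d+j}(m-1,m)=0$ for $1\le m\le j$ and $W_{d+j}(m-1,m)=\frac{m-j-1}{m-j}$ for $j+1\le m\le d$; - all other entries $0$.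
   Context: Rows and columns of matrices are indexed starting from $0$. All simplicial complexes are finite. For a $(d-1)$-dimensional simplicial complex $\Delta$ with $f_{i-1}$ faces of dimension $i-1$ ($f_{-1}=1$), the $h$-vector $h^\Delta=(h_0,\dots,h_d)$ is defined by $\sum_{i=0}^d h_i x^i=\sum_{i=0}^d f_{i-1}x^i(1-x)^{d-i}$. The barycentric subdivision of $\Delta$ is the simplicial complex of all chains in the poset of nonempty faces of $\Delta$ ordered by inclusion. Its transformation matrix $H_{\mathcal{F}}$ is the $(d+1)\times(d+1)$ matrix, depending only on $d$, such that $h^{\Delta'}=H_{\mathcal{F}}\,h^{\Delta}$ (column vectors) for every $(d-1)$-dimensional simplicial complex $\Delta$ with barycentric subdivision $\Delta'$. Explicitly (a known result of Brenti and Welker), $$H_{\mathcal F}=\left[\sum_{r=0}^{i} r^j (r+1)^{d-j}(-1)^{i-r}\binom{d+1}{i-r}\right]_{0\le i,j\le d},$$ with the convention $0^0=1$. *)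

theory Defs
  imports
    "Jordan_Normal_Form.Matrix"
    "HOL-Computational_Algebra.Polynomial"
    "HOL-Library.Infinite_Typeclass"
begin

text \<open>A complex is its set of faces, including the empty face (so that \<open>f\<^sub>-\<^sub>1 = 1\<close>).\<close>

definition abstract_simplicial_complex :: "'a set set \<Rightarrow> bool" where
  "abstract_simplicial_complex \<Delta> \<longleftrightarrow>
     finite \<Delta> \<and> {} \<in> \<Delta> \<and> (\<forall>\<sigma>\<in>\<Delta>. finite \<sigma> \<and> (\<forall>\<tau>. \<tau> \<subseteq> \<sigma> \<longrightarrow> \<tau> \<in> \<Delta>))"

definition complex_dim :: "'a set set \<Rightarrow> int" where
  "complex_dim \<Delta> = int (Max (card ` \<Delta>)) - 1"

text \<open>The index is shifted: \<open>face_number \<Delta> i\<close> is \<open>f\<close> at \<open>i - 1\<close>, as a face of dimension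
  \<open>i - 1\<close> has \<open>i\<close> vertices.\<close>

definition face_number :: "'a set set \<Rightarrow> nat \<Rightarrow> nat" where
  "face_number \<Delta> i = card {\<sigma> \<in> \<Delta>. card \<sigma> = i}"

definition h_polynomial :: "'a set set \<Rightarrow> real poly" where
  "h_polynomial \<Delta> = (let d = nat (complex_dim \<Delta> + 1) in
     \<Sum>i\<le>d. smult (of_nat (face_number \<Delta> i)) ([:0, 1:] ^ i * [:1, -1:] ^ (d - i)))"

definition h_vector :: "'a set set \<Rightarrow> real vec" where
  "h_vector \<Delta> = vec (nat (complex_dim \<Delta> + 1) + 1) (coeff (h_polynomial \<Delta>))"

text \<open>Vertices of the subdivision are the nonempty faces of \<open>\<Delta>\<close>; the empty chain is its
  empty face.\<close>

definition barycentric_subdivision :: "'a set set \<Rightarrow> 'a set set set" where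
  "barycentric_subdivision \<Delta> = chains (\<Delta> - {{}})"

text \<open>The type \<open>'a\<close> supplies the vertices. If it is infinite, then every finite complex is
  isomorphic to one over \<open>'a\<close>, so the quantifier ranges over all complexes of dimension
  \<open>d - 1\<close> up to isomorphism.\<close>

definition is_transformation_matrix ::
    "('a set set \<Rightarrow> 'b set set) \<Rightarrow> nat \<Rightarrow> real mat \<Rightarrow> bool" where
  "is_transformation_matrix F d H \<longleftrightarrow>
     H \<in> carrier_mat (d + 1) (d + 1) \<and>
     (\<forall>\<Delta>. abstract_simplicial_complex \<Delta> \<and> complex_dim \<Delta> = int d - 1 \<longrightarrow>
        h_vector (F \<Delta>) = H *\<^sub>v h_vector \<Delta>)"

definition transformation_matrix :: "('a set set \<Rightarrow> 'b set set) \<Rightarrow> nat \<Rightarrow> real mat" where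
  "transformation_matrix F d = (THE H. is_transformation_matrix F d H)"

definition W_lower :: "nat \<Rightarrow> nat \<Rightarrow> real mat" where
  "W_lower d i = mat (d + 1) (d + 1) (\<lambda>(r, c).
     if c = r then (if r < d - i then real r + 1 else 1)
     else if r = c + 1 then (if r < d - i then real d - real i - real r else 0)
     else 0)"

definition W_upper :: "nat \<Rightarrow> nat \<Rightarrow> real mat" where
  "W_upper d j = mat (d + 1) (d + 1) (\<lambda>(r, c).
     if c = r then 1
     else if c = r + 1 then
       (if c \<le> j then 0 else (real c - real j - 1) / (real c - real j))
     else 0)"

definition W :: "nat \<Rightarrow> nat \<Rightarrow> real mat" where
  "W d k = (if k < d then W_lower d k else W_upper d (k - d))"

definition mat_prod_list :: "nat \<Rightarrow> real mat list \<Rightarrow> real mat" where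
  "mat_prod_list n As = foldr (*) As (1\<^sub>m n)"

end

theory Submission
  imports Defs "HOL-Computational_Algebra.Polynomial_FPS"
begin

text \<open>
  A vector \<open>v\<close> of length \<open>d + 1\<close> is encoded by the sequence \<open>s\<close> with
  \<open>\<Sum> v\<^sub>i x\<^sup>i = (1 - x)\<^bsup>d+1\<^esup> \<Sum> s(m) x\<^sup>m\<close>. Each lower factor is one step of the
  Eulerian recursion, i.e. \<open>\<Sum> s(m) x\<^sup>m \<mapsto> (x \<Sum> s(m) x\<^sup>m)'\<close>, so column \<open>c\<close> of
  \<open>W\<^sub>0\<cdots>W\<^sub>d\<^sub>-\<^sub>1\<close> encodes \<open>binom(m, c) (m + 1)\<^bsup>d-c\<^esup>\<close>. The upper factors are column
  operations that, by Pascal-type identities, trade the binomial coefficient for powers of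
  \<open>m\<close>, until column \<open>c\<close> encodes \<open>m\<^sup>c (m + 1)\<^bsup>d-c\<^esup>\<close>.

  On the other hand, counting multichains of faces gives
  \<open>\<Sum> m\<^bsup>|\<sigma>|\<^esup> = \<Sum> binom(m, |C|)\<close>, the sums ranging over the faces \<open>\<sigma>\<close> of \<open>\<Delta>\<close> and the
  faces \<open>C\<close> of its subdivision. The left-hand side is \<open>\<Sum> h\<^sub>j m\<^sup>j (m + 1)\<^bsup>d-j\<^esup>\<close>, and the
  right-hand side encodes the \<open>h\<close>-vector of the subdivision. Uniqueness of the matrix holds
  because the \<open>h\<close>-vectors of disjoint unions of two simplices span the whole space.
\<close>

section \<open>Numerators of generating functions\<close>

definition gf_numerator :: "nat \<Rightarrow> (nat \<Rightarrow> real) \<Rightarrow> real fps" where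
  "gf_numerator n s = (1 - fps_X) ^ n * Abs_fps s"

lemma gf_numerator_add: "gf_numerator n (\<lambda>m. s m + t m) = gf_numerator n s + gf_numerator n t"
proof -
  have "Abs_fps (\<lambda>m. s m + t m) = Abs_fps s + Abs_fps t"
    by (rule fps_ext) simp
  then show ?thesis by (simp add: gf_numerator_def distrib_left)
qed

lemma gf_numerator_cmult: "gf_numerator n (\<lambda>m. c * s m) = fps_const c * gf_numerator n s"
proof -
  have "Abs_fps (\<lambda>m. c * s m) = fps_const c * Abs_fps s"
    by (rule fps_ext) simp
  then show ?thesis by (simp add: gf_numerator_def)
qed

lemma gf_numerator_sum:
  "gf_numerator n (\<lambda>m. \<Sum>x\<in>A. s x m) = (\<Sum>x\<in>A. gf_numerator n (s x))"
proof -
  have "Abs_fps (\<lambda>m. \<Sum>x\<in>A. s x m) = (\<Sum>x\<in>A. Abs_fps (s x))"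
    by (rule fps_ext) (simp add: fps_sum_nth)
  then show ?thesis by (simp add: gf_numerator_def sum_distrib_left)
qed

text \<open>With S the generating function of \<open>s\<close>, the new one is (x S)'. The product
  rule applied to x (1 - x)^n S leaves one correction, coming from the derivative of (1 -
  x)^n.\<close>

lemma gf_numerator_times_Suc:
  "gf_numerator (Suc n) (\<lambda>m. (real m + 1) * s m) =
     (1 - fps_X) * fps_deriv (fps_X * gf_numerator n s) + of_nat n * fps_X * gf_numerator n s"
proof -
  have S: "Abs_fps (\<lambda>m. (real m + 1) * s m) = fps_deriv (fps_X * Abs_fps s)"
    by (rule fps_ext) (simp del: fps_deriv_mult)
  define P :: "real fps" where "P = (1 - fps_X) ^ n"
  have D: "(1 - fps_X) * fps_deriv P = - (of_nat n * P)"
  proof (cases n)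
    case (Suc k)
    have "fps_deriv P = - (of_nat n * (1 - fps_X) ^ k)"
      using fps_deriv_power'[of "1 - fps_X :: real fps" n] by (simp add: Suc P_def del: of_nat_Suc)
    then have "(1 - fps_X) * fps_deriv P = - (of_nat n * ((1 - fps_X) * (1 - fps_X) ^ k))"
      by (simp only: mult_minus_right mult.left_commute)
    then show ?thesis by (simp add: P_def Suc)
  qed (simp add: P_def)
  have "(1 - fps_X) * fps_deriv (fps_X * (P * Abs_fps s)) + of_nat n * fps_X * (P * Abs_fps s) =
      (1 - fps_X) * P * fps_deriv (fps_X * Abs_fps s) +
      fps_X * Abs_fps s * ((1 - fps_X) * fps_deriv P + of_nat n * P)"
    by (simp add: algebra_simps)
  then show ?thesis
    unfolding gf_numerator_def S D by (simp add: P_def)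
qed

text \<open>For \<open>i < n\<close> and \<open>n \<le> d\<close>, the factors i + 1 and n - i are
  the entries in row \<open>i\<close> of \<open>W_lower d (d - n)\<close>.\<close>

lemma gf_numerator_times_Suc_nth:
  "fps_nth (gf_numerator (Suc n) (\<lambda>m. (real m + 1) * s m)) i =
     (real i + 1) * fps_nth (gf_numerator n s) i +
     (if i = 0 then 0 else (real n - real i) * fps_nth (gf_numerator n s) (i - 1))"
proof -
  have "fps_nth (of_nat n * fps_X * gf_numerator n s) i =
      real n * (if i = 0 then 0 else fps_nth (gf_numerator n s) (i - 1))"
    by (simp add: mult.assoc flip: fps_of_nat)
  then show ?thesis
    unfolding gf_numerator_times_Suc left_diff_distrib fps_add_nth
    by (cases i) (simp_all add: left_diff_distrib distrib_right del: fps_deriv_mult)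
qed

text \<open>Pascal's rule says that raising \<open>c\<close> by one multiplies the generating
  function by x / (1 - x).\<close>

lemma gf_numerator_binomial: "gf_numerator (Suc c) (\<lambda>m. real (m choose c)) = fps_X ^ c"
proof (induction c)
  case 0
  show ?case
    by (rule fps_ext) (simp add: gf_numerator_def left_diff_distrib)
next
  case (Suc c)
  let ?B = "\<lambda>c. Abs_fps (\<lambda>m. real (m choose c))"
  have "?B (Suc c) = fps_X * (?B c + ?B (Suc c))"
  proof (rule fps_ext)
    fix m show "fps_nth (?B (Suc c)) m = fps_nth (fps_X * (?B c + ?B (Suc c))) m"
      by (cases m) simp_all
  qed
  then have "(1 - fps_X) * ?B (Suc c) = fps_X * ?B c"
    by (simp add: algebra_simps)
  then have "(1 - fps_X) ^ Suc c * ((1 - fps_X) * ?B (Suc c)) =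
      fps_X * ((1 - fps_X) ^ Suc c * ?B c)"
    by (simp only: mult.left_commute)
  then have "gf_numerator (Suc (Suc c)) (\<lambda>m. real (m choose Suc c)) =
      fps_X * gf_numerator (Suc c) (\<lambda>m. real (m choose c))"
    by (simp only: gf_numerator_def power_Suc2[of _ "Suc c"] mult.assoc)
  with Suc.IH show ?case by simp
qed

text \<open>Each recursion step raises the degree of the numerator by at most one. This is what
  allows the lower factors to have identity rows from some row on.\<close>

lemma gf_numerator_eulerian_nth_eq_0:
  assumes "c \<le> n" "n < i"
  shows "fps_nth (gf_numerator (Suc n) (\<lambda>m. real (m choose c) * (real m + 1) ^ (n - c))) i = 0"
  using assms
proof (induction n arbitrary: i rule: dec_induct)
  case base
  then show ?case by (simp add: gf_numerator_binomial fps_X_power_nth)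
next
  case (step n)
  have "(\<lambda>m. real (m choose c) * (real m + 1) ^ (Suc n - c)) =
      (\<lambda>m. (real m + 1) * (real (m choose c) * (real m + 1) ^ (n - c)))"
    using step.hyps by (auto simp: Suc_diff_le)
  then show ?case
    using step.IH[of i] step.IH[of "i - 1"] step.prems
    by (simp add: gf_numerator_times_Suc_nth)
qed

section \<open>Products of bidiagonal matrices\<close>

lemma sum_bidiagonal:
  fixes f :: "nat \<Rightarrow> 'a :: comm_semiring_0"
  assumes "i < N"
  shows "(\<Sum>k = 0..<N. (if k = i then a else if i = k + 1 then b else 0) * f k) =
    a * f i + (if i = 0 then 0 else b * f (i - 1))"
proof -
  have "(\<Sum>k = 0..<N. (if k = i then a else if i = k + 1 then b else 0) * f k) =
     (\<Sum>k = 0..<N. (if k = i then a * f i else 0) +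
        (if k = i - 1 then if i = 0 then 0 else b * f (i - 1) else 0))"
    by (rule sum.cong) auto
  also have "\<dots> = a * f i + (if i = 0 then 0 else b * f (i - 1))"
    using assms by (cases i) (simp_all add: sum.distrib)
  finally show ?thesis .
qed

lemma index_mult_mat_eq_sum:
  assumes "A \<in> carrier_mat n m" "B \<in> carrier_mat m p" "i < n" "j < p"
  shows "(A * B) $$ (i, j) = (\<Sum>k = 0..<m. A $$ (i, k) * B $$ (k, j))"
  using assms by (auto simp: scalar_prod_def intro!: sum.cong)

lemma W_carrier [simp]: "W d k \<in> carrier_mat (Suc d) (Suc d)"
  by (simp add: W_def W_lower_def W_upper_def)

lemma mat_prod_list_Nil [simp]: "mat_prod_list n [] = 1\<^sub>m n"
  by (simp add: mat_prod_list_def)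

lemma mat_prod_list_Cons [simp]: "mat_prod_list n (A # As) = A * mat_prod_list n As"
  by (simp add: mat_prod_list_def)

lemma mat_prod_list_carrier:
  "set As \<subseteq> carrier_mat n n \<Longrightarrow> mat_prod_list n As \<in> carrier_mat n n"
  by (induction As) auto

lemma mat_prod_list_snoc:
  assumes "set As \<subseteq> carrier_mat n n" "A \<in> carrier_mat n n"
  shows "mat_prod_list n (As @ [A]) = mat_prod_list n As * A"
  using assms
  by (induction As) (auto simp: assoc_mult_mat[where ?n\<^sub>2.0 = n and ?n\<^sub>3.0 = n] mat_prod_list_carrier)

text \<open>The product grows by factors on the left. Columns beyond \<open>n\<close> are still unit
  vectors; column \<open>n\<close> is one too, since its numerator is x^n, and from there on it
  follows the recursion.\<close>

lemma prod_W_lower: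
  assumes "n \<le> d"
  shows "mat_prod_list (d + 1) (map (W d) [d - n..<d]) =
    mat (d + 1) (d + 1) (\<lambda>(i, c).
      if c \<le> n
      then fps_nth (gf_numerator (Suc n) (\<lambda>m. real (m choose c) * (real m + 1) ^ (n - c))) i
      else if i = c then 1 else 0)" (is "?P n = mat _ _ (?f n)")
  using assms
proof (induction n)
  case 0
  have "gf_numerator (Suc 0) (\<lambda>m. 1) = 1"
    using gf_numerator_binomial[of 0] by simp
  then show ?case by (auto intro!: eq_matI)
next
  case (Suc n)
  have "[d - Suc n..<d] = (d - Suc n) # [d - n..<d]"
    using Suc.prems by (simp add: upt_conv_Cons Suc_diff_Suc)
  then have P: "?P (Suc n) = W_lower d (d - Suc n) * ?P n"
    using Suc.prems by (simp add: W_def)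
  have "(W_lower d (d - Suc n) * ?P n) $$ (i, c) = ?f (Suc n) (i, c)"
    if ic: "i < d + 1" "c < d + 1" for i c
  proof -
    have d: "d - (d - Suc n) = Suc n" "real (d - Suc n) = real d - real (Suc n)"
      using Suc.prems by auto
    have "(W_lower d (d - Suc n) * ?P n) $$ (i, c) =
      (\<Sum>k = 0..<d + 1. (if k = i then if i < Suc n then real i + 1 else 1
         else if i = k + 1 then if i < Suc n then real (Suc n) - real i else 0 else 0)
         * ?f n (k, c))"
      using ic unfolding Suc.IH[OF Suc_leD[OF Suc.prems]]
      by (subst index_mult_mat_eq_sum[where m = "d + 1" and n = "d + 1" and p = "d + 1"],
          simp_all only: W_lower_def d mat_carrier)
        (rule sum.cong, simp_all)
    also have "\<dots> = (if i < Suc n then real i + 1 else 1) * ?f n (i, c) +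
        (if i = 0 then 0 else (if i < Suc n then real (Suc n) - real i else 0) * ?f n (i - 1, c))"
      using ic by (subst sum_bidiagonal) simp_all
    also have "\<dots> = ?f (Suc n) (i, c)"
    proof (cases "c \<le> n")
      case True
      then have eq: "(\<lambda>m. real (m choose c) * (real m + 1) ^ (Suc n - c)) =
          (\<lambda>m. (real m + 1) * (real (m choose c) * (real m + 1) ^ (n - c)))"
        by (auto simp: Suc_diff_le)
      have step: "?f (Suc n) (i, c) = (real i + 1) * ?f n (i, c) +
          (if i = 0 then 0 else (real (Suc n) - real i) * ?f n (i - 1, c))"
        using True by (simp only: prod.case eq gf_numerator_times_Suc_nth) simp
      show ?thesis
      proof (cases "i < Suc n")
        case True
        then show ?thesis unfolding step by simp
      next
        \<comment> \<open>The factor has an identity row here while the recursion does not. They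
          agree because the entries involved vanish by the degree bound, or, for the lower neighbour
          at \<open>i = Suc n\<close>, because its coefficient is 0.\<close>
        case False
        then show ?thesis
          using \<open>c \<le> n\<close> gf_numerator_eulerian_nth_eq_0[of c n i]
            gf_numerator_eulerian_nth_eq_0[of c n "i - 1"]
          unfolding step by (cases "i = Suc n") simp_all
      qed
    next
      case False
      then show ?thesis
        by (cases "c = Suc n") (auto simp: gf_numerator_binomial fps_X_power_nth)
    qed
    finally show ?thesis .
  qed
  then show ?case unfolding P Suc.IH[OF Suc_leD[OF Suc.prems]]
    by (intro eq_matI) (auto simp: W_lower_def)
qed

text \<open>The sequence encoded by column \<open>c\<close> of \<open>W\<^sub>0\<cdots>W\<^sub>d\<^sub>+\<^sub>k\<^sub>-\<^sub>1\<close>; for \<open>c \<le> k\<close> the truncated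
  subtraction \<open>c - k = 0\<close> makes the binomial coefficient \<open>1\<close>.\<close>

definition upper_stage :: "nat \<Rightarrow> nat \<Rightarrow> nat \<Rightarrow> nat \<Rightarrow> real" where
  "upper_stage d k c m =
     real m ^ min k c * real (m choose (c - k)) * (real m + 1) ^ (d - c)"

text \<open>Write c = k + l + 1. After a common factor is removed, the claim is (m - l) / (l + 1) +
  l (m + 1) / (l + 1) = m, and l / (l + 1) is the superdiagonal entry of \<open>W_upper d k\<close>
  in column \<open>c\<close>.\<close>

lemma upper_stage_Suc:
  assumes "c \<le> d" "k < c"
  shows "upper_stage d (Suc k) c m =
    upper_stage d k c m + (real c - real k - 1) / (real c - real k) * upper_stage d k (c - 1) m"
proof -
  obtain l where c: "c = Suc (k + l)"
    using \<open>k < c\<close> less_iff_Suc_add by auto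
  have "Suc d - c = Suc (d - c)" using assms by (simp add: Suc_diff_le)
  then have pow: "(real m + 1) ^ (d - (k + l)) = (real m + 1) * (real m + 1) ^ (d - c)"
    by (simp add: c)
  have "(real l + 1) * real (m choose Suc l) = (real m - real l) * real (m choose l)"
  proof (cases "l \<le> m")
    case True
    have "Suc l * (m choose Suc l) = (m - l) * (m choose l)"
      by (simp only: binomial_absorption binomial_absorb_comp)
    then have "real (Suc l * (m choose Suc l)) = real ((m - l) * (m choose l))"
      by (simp only:)
    with True show ?thesis by (simp add: of_nat_diff algebra_simps)
  \<comment> \<open>For \<open>l > m\<close> both binomial coefficients are 0, so the possibly
    negative m - l does no harm.\<close>
  qed (simp add: binomial_eq_0)
  then have bin: "real (m choose Suc l) = (real m - real l) * real (m choose l) / (real l + 1)"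
    by (simp add: field_simps)
  have diff: "c - k = Suc l" "c - 1 = k + l" "min (Suc k) c = Suc k" "min k c = k" "min k (k + l) = k"
    "c - Suc k = l" "k + l - k = l" "real c - real k - 1 = real l" "real c - real k = real l + 1"
    using c by auto
  define A where "A = real m ^ k * (real m + 1) ^ (d - c)"
  have "upper_stage d k c m + real l / (real l + 1) * upper_stage d k (c - 1) m =
      A * real (m choose l) * ((real m - real l) / (real l + 1) + real l / (real l + 1) * (real m + 1))"
  proof -
    have "a * (u * b / y) * p + z / y * (a * b * (v * p)) = a * p * b * (u / y + z / y * v)"
      for a u b y p z v :: real
      by (simp add: algebra_simps)
    then show ?thesis
      unfolding upper_stage_def diff pow bin A_def .
  qed
  also have "(real m - real l) / (real l + 1) + real l / (real l + 1) * (real m + 1) = real m"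
  proof -
    have "real m - real l + real l * (real m + 1) = real m * (real l + 1)"
      by (simp add: algebra_simps)
    then show ?thesis
      by (simp add: nonzero_divide_eq_eq flip: add_divide_distrib)
  qed
  finally show ?thesis
    unfolding diff by (simp add: upper_stage_def diff A_def)
qed

text \<open>Right multiplication by \<open>W_upper d k\<close> adds to each column
  \<open>c > k\<close> a multiple of column \<open>c - 1\<close> and fixes the others. As
  \<open>gf_numerator\<close> is linear, the same operation acts on the encoded sequences.\<close>

lemma prod_W:
  assumes "k \<le> d"
  shows "mat_prod_list (d + 1) (map (W d) [0..<d + k]) =
    mat (d + 1) (d + 1) (\<lambda>(i, c). fps_nth (gf_numerator (d + 1) (upper_stage d k c)) i)"
    (is "?P k = mat _ _ (?f k)")
  using assms
proof (induction k)
  case 0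
  show ?case using prod_W_lower[of d d]
    by (auto simp: upper_stage_def[abs_def] intro!: eq_matI)
next
  case (Suc k)
  have P: "?P (Suc k) = ?P k * W_upper d k"
  proof -
    have "W_upper d k = W d (d + k)" by (simp add: W_def)
    then show ?thesis
      using mat_prod_list_snoc[of "map (W d) [0..<d + k]" "d + 1" "W d (d + k)"]
      by (simp add: image_subset_iff)
  qed
  have "(?P k * W_upper d k) $$ (i, c) = ?f (Suc k) (i, c)"
    if ic: "i < d + 1" "c < d + 1" for i c
  proof -
    let ?b = "if c \<le> k then 0 else (real c - real k - 1) / (real c - real k)"
    have "(?P k * W_upper d k) $$ (i, c) =
        (\<Sum>l = 0..<d + 1. (if l = c then 1 else if c = l + 1 then ?b else 0) * ?f k (i, l))"
      using ic unfolding Suc.IH[OF Suc_leD[OF Suc.prems]]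
      by (subst index_mult_mat_eq_sum[where m = "d + 1" and n = "d + 1" and p = "d + 1"])
        (auto simp: W_upper_def intro!: sum.cong)
    also have "\<dots> = ?f k (i, c) + (if c = 0 then 0 else ?b * ?f k (i, c - 1))"
      using ic by (subst sum_bidiagonal) simp_all
    also have "\<dots> = ?f (Suc k) (i, c)"
    proof (cases "c \<le> k")
      case True
      then have "upper_stage d (Suc k) c = upper_stage d k c"
        by (auto simp: upper_stage_def min_def)
      with True show ?thesis by simp
    next
      case False
      then have "upper_stage d (Suc k) c = (\<lambda>m. upper_stage d k c m +
          (real c - real k - 1) / (real c - real k) * upper_stage d k (c - 1) m)"
        using ic upper_stage_Suc[of c d k] by auto
      with False show ?thesis
        by (simp only: prod.case gf_numerator_add gf_numerator_cmult) simp
    qed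
    finally show ?thesis .
  qed
  moreover have "?P k \<in> carrier_mat (d + 1) (d + 1)"
    by (rule mat_prod_list_carrier) auto
  ultimately show ?case unfolding P
    by (intro eq_matI) (auto simp: W_upper_def)
qed

text \<open>Expanding (1 - x)^(d+1) turns these entries into the explicit alternating sums of Brenti
  and Welker.\<close>

lemma prod_all_W:
  "mat_prod_list (d + 1) (map (W d) [0..<2 * d]) =
    mat (d + 1) (d + 1) (\<lambda>(i, j).
      fps_nth (gf_numerator (d + 1) (\<lambda>m. real m ^ j * (real m + 1) ^ (d - j))) i)"
proof -
  have "upper_stage d d j = (\<lambda>m. real m ^ j * (real m + 1) ^ (d - j))" if "j \<le> d" for j
    using that by (simp add: upper_stage_def[abs_def] min_def)
  then show ?thesis
    unfolding mult_2 prod_W[OF order_refl] by (intro eq_matI) auto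
qed

section \<open>Chains with a prescribed union\<close>

definition chains_onto :: "'a set \<Rightarrow> 'a set set set" where
  "chains_onto \<sigma> = {C \<in> chains (Pow \<sigma> - {{}}). \<Union>C = \<sigma>}"

lemma finite_chains_onto: "finite \<sigma> \<Longrightarrow> finite (chains_onto \<sigma>)"
  by (rule finite_subset[of _ "Pow (Pow \<sigma>)"]) (auto simp: chains_onto_def chains_def)

lemma finite_mem_chains_onto: "finite \<sigma> \<Longrightarrow> C \<in> chains_onto \<sigma> \<Longrightarrow> finite C"
  by (rule finite_subset[of _ "Pow \<sigma>"]) (auto simp: chains_onto_def chains_def)

lemma chains_onto_empty [simp]: "chains_onto {} = {{}}"
  by (auto simp: chains_onto_def chains_def chain_subset_def)

text \<open>Hence, for finite nonempty \<sigma>, \<open>chains_onto \<sigma>\<close> consists of the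
  chains with greatest element \<sigma>; the empty chain belongs to the empty face.\<close>

lemma Union_mem_finite_chain:
  assumes "C \<in> chains A" "finite C" "C \<noteq> {}"
  shows "\<Union>C \<in> C"
  using assms Union_in_chain[of C A] by (simp add: chains_alt_def)

lemma insert_mem_chains_onto:
  assumes "\<tau> \<subset> \<sigma>" "C \<in> chains_onto \<tau>"
  shows "insert \<sigma> C \<in> chains_onto \<sigma>"
  using assms by (auto simp: chains_onto_def chains_def chain_subset_def)

text \<open>What remains after removing \<sigma> is empty or contains its own union, so that union
  is a proper subset of \<sigma>. Removal is thus inverse to
  \<open>insert_mem_chains_onto\<close>.\<close>

lemma chains_onto_remove_top:
  assumes "finite \<sigma>" "\<sigma> \<noteq> {}" "C \<in> chains_onto \<sigma>"
  shows "\<sigma> \<in> C" "C - {\<sigma>} \<in> (\<Union>\<tau>\<in>Pow \<sigma> - {\<sigma>}. chains_onto \<tau>)"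
proof -
  have C: "C \<in> chains (Pow \<sigma> - {{}})" "\<Union>C = \<sigma>" and fin: "finite C"
    using assms finite_mem_chains_onto by (auto simp: chains_onto_def)
  then show "\<sigma> \<in> C"
    using Union_mem_finite_chain[OF C(1) fin] \<open>\<sigma> \<noteq> {}\<close> by auto
  let ?D = "C - {\<sigma>}"
  have D: "?D \<in> chains (Pow \<sigma> - {{}})"
    using C(1) by (auto simp: chains_def chain_subset_def)
  have "\<Union>?D \<noteq> \<sigma>"
    using Union_mem_finite_chain[OF D] fin \<open>\<sigma> \<noteq> {}\<close> by (cases "?D = {}") auto
  moreover have "\<Union>?D \<subseteq> \<sigma>" using C(2) by auto
  moreover have "?D \<in> chains_onto (\<Union>?D)"
    using D by (auto simp: chains_onto_def chains_def)
  ultimately show "?D \<in> (\<Union>\<tau>\<in>Pow \<sigma> - {\<sigma>}. chains_onto \<tau>)" by blast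
qed

lemma disjoint_chains_onto: "\<sigma> \<noteq> \<tau> \<Longrightarrow> chains_onto \<sigma> \<inter> chains_onto \<tau> = {}"
  by (auto simp: chains_onto_def)

text \<open>Binomial theorem over subsets: each B records the factors from which x is taken. It
  serves the chain count with y = 1 and the h-polynomial of a simplex with x and 1 - x.\<close>

lemma sum_Pow_power_card:
  assumes "finite A"
  shows "(\<Sum>B\<in>Pow A. x ^ card B * y ^ (card A - card B)) =
    (x + y :: 'a :: comm_semiring_1) ^ card A"
proof -
  have "(x + y) ^ card A = (\<Sum>B\<in>Pow A. (\<Prod>_\<in>B. x) * (\<Prod>_\<in>A - B. y))"
    using prod_add[OF assms, of "\<lambda>_. x" "\<lambda>_. y"] by simp
  also have "\<dots> = (\<Sum>B\<in>Pow A. x ^ card B * y ^ (card A - card B))"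
    using assms by (intro sum.cong) (auto simp: card_Diff_subset finite_subset)
  finally show ?thesis by simp
qed

text \<open>A chain with top \<open>\<sigma>\<close> is \<open>\<sigma>\<close> together with a chain onto a proper subset of \<open>\<sigma>\<close>, so
  Pascal's rule turns the step \<open>m \<rightarrow> m + 1\<close> into a sum over all subsets of \<open>\<sigma>\<close>.\<close>

lemma sum_choose_chains_onto:
  assumes "finite \<sigma>"
  shows "(\<Sum>C\<in>chains_onto \<sigma>. m choose card C) = m ^ card \<sigma>"
  using assms
proof (induction m arbitrary: \<sigma>)
  case 0
  show ?case
  proof (cases "\<sigma> = {}")
    case False
    \<comment> \<open>At m = 0 only the empty chain would contribute, and its union is not
      \<sigma>.\<close>
    have "card C > 0" if "C \<in> chains_onto \<sigma>" for C
      using that chains_onto_remove_top(1)[OF 0 False that] finite_mem_chains_onto[OF 0 that]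
      by (auto simp: card_gt_0_iff)
    then have "(\<Sum>C\<in>chains_onto \<sigma>. 0 choose card C) = 0" by (simp add: binomial_eq_0)
    with False 0 show ?thesis by (simp add: card_gt_0_iff)
  qed simp
next
  case (Suc m)
  show ?case
  proof (cases "\<sigma> = {}")
    case False
    let ?S = "chains_onto \<sigma>" and ?T = "Pow \<sigma> - {\<sigma>}"
    have pascal: "Suc m choose card C = (m choose card C) + (m choose card (C - {\<sigma>}))"
      if "C \<in> ?S" for C
    proof -
      have "card C = Suc (card (C - {\<sigma>}))"
        using chains_onto_remove_top(1)[OF Suc.prems False that]
          finite_mem_chains_onto[OF Suc.prems that] by (simp only: card_Suc_Diff1)
      then show ?thesis by simp
    qed
    have "(\<Sum>C\<in>?S. m choose card (C - {\<sigma>})) = (\<Sum>D\<in>(\<Union>\<tau>\<in>?T. chains_onto \<tau>). m choose card D)"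
    proof (rule sum.reindex_bij_witness[where i = "insert \<sigma>" and j = "\<lambda>C. C - {\<sigma>}"])
      fix C assume "C \<in> ?S"
      with chains_onto_remove_top[OF Suc.prems False this]
      show "insert \<sigma> (C - {\<sigma>}) = C" "C - {\<sigma>} \<in> (\<Union>\<tau>\<in>?T. chains_onto \<tau>)" by auto
    next
      fix D assume "D \<in> (\<Union>\<tau>\<in>?T. chains_onto \<tau>)"
      then obtain \<tau> where \<tau>: "\<tau> \<subset> \<sigma>" "D \<in> chains_onto \<tau>" by auto
      then have "\<sigma> \<notin> D" by (auto simp: chains_onto_def chains_def)
      then show "insert \<sigma> D - {\<sigma>} = D" by simp
      show "insert \<sigma> D \<in> ?S" using \<tau> by (rule insert_mem_chains_onto)
    qed auto
    also have "\<dots> = (\<Sum>\<tau>\<in>?T. \<Sum>D\<in>chains_onto \<tau>. m choose card D)"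
      using Suc.prems
      by (intro sum.UNION_disjoint ballI impI finite_chains_onto disjoint_chains_onto)
        (auto intro: finite_subset)
    also have "\<dots> = (\<Sum>\<tau>\<in>?T. m ^ card \<tau>)"
      using Suc.prems by (intro sum.cong refl Suc.IH) (auto intro: finite_subset)
    finally have "(\<Sum>C\<in>?S. Suc m choose card C) = m ^ card \<sigma> + (\<Sum>\<tau>\<in>?T. m ^ card \<tau>)"
      by (simp add: pascal sum.distrib Suc.IH Suc.prems cong: sum.cong)
    also have "\<dots> = (\<Sum>\<tau>\<in>Pow \<sigma>. m ^ card \<tau>)"
      using Suc.prems by (subst sum.remove[of "Pow \<sigma>" \<sigma>]) auto
    also have "\<dots> = Suc m ^ card \<sigma>"
      using sum_Pow_power_card[OF Suc.prems, of m 1] by simp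
    finally show ?thesis .
  qed simp
qed

text \<open>The union of a nonempty chain of faces is its top, hence a face; conversely, \<Delta> is
  closed under subsets. The union is disjoint, so sums over the subdivision split by top
  face.\<close>

lemma barycentric_subdivision_eq_UN:
  assumes "abstract_simplicial_complex \<Delta>"
  shows "barycentric_subdivision \<Delta> = (\<Union>\<sigma>\<in>\<Delta>. chains_onto \<sigma>)"
proof (intro equalityI subsetI)
  fix C assume C: "C \<in> barycentric_subdivision \<Delta>"
  have "finite C"
    using C assms unfolding barycentric_subdivision_def abstract_simplicial_complex_def chains_def
    by (auto intro: finite_subset[of C \<Delta>])
  with C assms have "\<Union>C \<in> \<Delta>"
    using Union_mem_finite_chain[of C "\<Delta> - {{}}"]
    unfolding barycentric_subdivision_def abstract_simplicial_complex_def
    by (cases "C = {}") (auto simp: chains_def)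
  moreover have "C \<in> chains_onto (\<Union>C)"
    using C by (auto simp: barycentric_subdivision_def chains_onto_def chains_def)
  ultimately show "C \<in> (\<Union>\<sigma>\<in>\<Delta>. chains_onto \<sigma>)" by blast
next
  fix C assume "C \<in> (\<Union>\<sigma>\<in>\<Delta>. chains_onto \<sigma>)"
  with assms show "C \<in> barycentric_subdivision \<Delta>"
    unfolding barycentric_subdivision_def abstract_simplicial_complex_def chains_onto_def chains_def
    by blast
qed

lemma sum_choose_barycentric_subdivision:
  assumes "abstract_simplicial_complex \<Delta>"
  shows "(\<Sum>C\<in>barycentric_subdivision \<Delta>. m choose card C) = (\<Sum>\<sigma>\<in>\<Delta>. m ^ card \<sigma>)"
proof -
  have fin: "finite \<Delta>" "\<And>\<sigma>. \<sigma> \<in> \<Delta> \<Longrightarrow> finite \<sigma>"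
    using assms by (auto simp: abstract_simplicial_complex_def)
  have "(\<Sum>C\<in>barycentric_subdivision \<Delta>. m choose card C) =
      (\<Sum>\<sigma>\<in>\<Delta>. \<Sum>C\<in>chains_onto \<sigma>. m choose card C)"
    unfolding barycentric_subdivision_eq_UN[OF assms]
    by (intro sum.UNION_disjoint ballI impI finite_chains_onto disjoint_chains_onto fin)
  then show ?thesis using fin by (simp add: sum_choose_chains_onto)
qed

section \<open>Dimension of the subdivision\<close>

lemma ex_full_chain:
  assumes "finite \<sigma>"
  shows "\<exists>C\<in>chains_onto \<sigma>. card C = card \<sigma>"
  using assms
proof (induction \<sigma> rule: finite_induct)
  case (insert x \<sigma>)
  then obtain C where C: "C \<in> chains_onto \<sigma>" "card C = card \<sigma>" by blast
  have "insert x \<sigma> \<notin> C" using C(1) insert.hyps by (auto simp: chains_onto_def)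
  with C insert.hyps have "card (insert (insert x \<sigma>) C) = card (insert x \<sigma>)"
    using finite_mem_chains_onto[of \<sigma> C] by simp
  moreover have "insert (insert x \<sigma>) C \<in> chains_onto (insert x \<sigma>)"
    using C(1) insert.hyps by (intro insert_mem_chains_onto[of \<sigma>]) auto
  ultimately show ?case by blast
qed simp

text \<open>Comparable finite sets of equal size coincide, so the members of a chain have distinct
  sizes between 1 and \<open>card \<sigma>\<close>.\<close>

lemma card_mem_chains_onto_le:
  assumes "finite \<sigma>" "C \<in> chains_onto \<sigma>"
  shows "card C \<le> card \<sigma>"
proof -
  have C: "C \<subseteq> Pow \<sigma>" "{} \<notin> C" "\<And>A B. A \<in> C \<Longrightarrow> B \<in> C \<Longrightarrow> A \<subseteq> B \<or> B \<subseteq> A"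
    using assms(2) by (auto simp: chains_onto_def chains_def chain_subset_def)
  have "inj_on card C"
  proof (rule inj_onI)
    fix A B assume "A \<in> C" "B \<in> C" "card A = card B"
    moreover have "finite A" "finite B"
      using calculation C(1) assms(1) by (auto intro: finite_subset)
    ultimately show "A = B" using C(3)[of A B] card_subset_eq[of A B] card_subset_eq[of B A] by auto
  qed
  moreover have "card ` C \<subseteq> {1..card \<sigma>}"
  proof (rule image_subsetI)
    fix A assume "A \<in> C"
    with C(1,2) assms(1) have "A \<subseteq> \<sigma>" "A \<noteq> {}" "finite A" by (auto intro: finite_subset)
    with assms(1) show "card A \<in> {1..card \<sigma>}"
      by (simp add: card_mono Suc_le_eq card_gt_0_iff)
  qed
  ultimately have "card C \<le> card {1..card \<sigma>}"
    by (rule card_inj_on_le) simp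
  then show ?thesis by simp
qed

lemma complex_dim_eq_iff:
  assumes "finite \<Delta>" "\<Delta> \<noteq> {}"
  shows "complex_dim \<Delta> = int d - 1 \<longleftrightarrow> (\<forall>\<sigma>\<in>\<Delta>. card \<sigma> \<le> d) \<and> (\<exists>\<sigma>\<in>\<Delta>. card \<sigma> = d)"
  using assms Max_eq_iff[of "card ` \<Delta>" d] by (auto simp: complex_dim_def)

lemma barycentric_subdivision_finite:
  assumes "abstract_simplicial_complex \<Delta>"
  shows "finite (barycentric_subdivision \<Delta>)" "barycentric_subdivision \<Delta> \<noteq> {}"
proof -
  show "finite (barycentric_subdivision \<Delta>)"
    using assms unfolding barycentric_subdivision_eq_UN[OF assms] abstract_simplicial_complex_def
    by (auto intro: finite_chains_onto)
  have "{} \<in> barycentric_subdivision \<Delta>"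
    by (simp add: barycentric_subdivision_def chains_def chain_subset_def)
  then show "barycentric_subdivision \<Delta> \<noteq> {}" by blast
qed

text \<open>Needed because \<open>h_polynomial\<close> and \<open>h_vector\<close> read d off the
  complex they are given.\<close>

lemma complex_dim_barycentric_subdivision:
  assumes "abstract_simplicial_complex \<Delta>" "complex_dim \<Delta> = int d - 1"
  shows "complex_dim (barycentric_subdivision \<Delta>) = int d - 1"
proof -
  have \<Delta>: "finite \<Delta>" "\<Delta> \<noteq> {}" "\<And>\<sigma>. \<sigma> \<in> \<Delta> \<Longrightarrow> finite \<sigma>"
    using assms(1) by (auto simp: abstract_simplicial_complex_def)
  then have d: "\<forall>\<sigma>\<in>\<Delta>. card \<sigma> \<le> d" "\<exists>\<sigma>\<in>\<Delta>. card \<sigma> = d"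
    using assms(2) complex_dim_eq_iff by auto
  have "\<forall>C\<in>barycentric_subdivision \<Delta>. card C \<le> d"
    unfolding barycentric_subdivision_eq_UN[OF assms(1)]
    using \<Delta>(3) d(1) card_mem_chains_onto_le by (blast intro: order_trans)
  moreover have "\<exists>C\<in>barycentric_subdivision \<Delta>. card C = d"
    unfolding barycentric_subdivision_eq_UN[OF assms(1)]
    using \<Delta>(3) d(2) ex_full_chain by blast
  ultimately show ?thesis
    using complex_dim_eq_iff[OF barycentric_subdivision_finite[OF assms(1)]] by blast
qed

section \<open>Evaluating and encoding the h-polynomial\<close>

lemma h_polynomial_eq_sum_faces:
  assumes "finite \<Delta>" "complex_dim \<Delta> = int d - 1"
  shows "h_polynomial \<Delta> = (\<Sum>\<sigma>\<in>\<Delta>. [:0, 1:] ^ card \<sigma> * [:1, -1:] ^ (d - card \<sigma>))"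
proof -
  let ?g = "\<lambda>i. [:0, 1:] ^ i * [:1, -1:] ^ (d - i) :: real poly"
  have Max: "Max (card ` \<Delta>) = d" using assms(2) by (simp add: complex_dim_def)
  have "h_polynomial \<Delta> = (\<Sum>i\<le>d. \<Sum>\<sigma> | \<sigma> \<in> \<Delta> \<and> card \<sigma> = i. ?g (card \<sigma>))"
    using assms(2)
    by (auto simp: h_polynomial_def Let_def face_number_def of_nat_poly intro!: sum.cong)
  also have "\<dots> = (\<Sum>\<sigma>\<in>\<Delta>. ?g (card \<sigma>))"
    using assms(1) Max by (intro sum.group) auto
  finally show ?thesis .
qed

lemma degree_h_polynomial_le:
  assumes "finite \<Delta>" "complex_dim \<Delta> = int d - 1"
  shows "degree (h_polynomial \<Delta>) \<le> d"
  unfolding h_polynomial_eq_sum_faces[OF assms]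
proof (rule degree_sum_le[OF assms(1)])
  fix \<sigma> assume "\<sigma> \<in> \<Delta>"
  then have "card \<sigma> \<le> d"
    using assms Max_ge[of "card ` \<Delta>" "card \<sigma>"] by (simp add: complex_dim_def)
  moreover have "degree ([:0, 1:] ^ card \<sigma> * [:1, -1:] ^ (d - card \<sigma>) :: real poly) \<le>
      card \<sigma> + (d - card \<sigma>)"
    by (intro order_trans[OF degree_mult_le] add_mono order_trans[OF degree_power_le]) auto
  ultimately show "degree ([:0, 1:] ^ card \<sigma> * [:1, -1:] ^ (d - card \<sigma>) :: real poly) \<le> d"
    by simp
qed

text \<open>Both sides are (m + 1)^d times the value of the h-polynomial at m / (m + 1), computed
  once from its coefficients and once from the faces.\<close>

lemma sum_coeff_h_polynomial:
  assumes "finite \<Delta>" "complex_dim \<Delta> = int d - 1"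
  shows "(\<Sum>j\<le>d. coeff (h_polynomial \<Delta>) j * (real m ^ j * (real m + 1) ^ (d - j))) =
    (\<Sum>\<sigma>\<in>\<Delta>. real m ^ card \<sigma>)"
proof -
  define x where "x = real m / (real m + 1)"
  \<comment> \<open>Used with y = 1 for the coefficients and with y = 1 - x, where (m + 1) y = 1,
    for the faces.\<close>
  have x: "(real m + 1) ^ d * (x ^ j * y ^ (d - j)) = real m ^ j * ((real m + 1) * y) ^ (d - j)"
    if "j \<le> d" for j y
  proof -
    have "(real m + 1) ^ d = (real m + 1) ^ j * (real m + 1) ^ (d - j)"
      using that by (simp flip: power_add)
    moreover have "((real m + 1) * x) ^ j = real m ^ j" by (simp add: x_def)
    ultimately show ?thesis by (simp add: power_mult_distrib)
  qed
  have "(\<Sum>j\<le>d. coeff (h_polynomial \<Delta>) j * (real m ^ j * (real m + 1) ^ (d - j))) =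
      (\<Sum>j\<le>d. (real m + 1) ^ d * (coeff (h_polynomial \<Delta>) j * x ^ j))"
    using x[of _ 1] by (intro sum.cong) (simp_all add: mult.left_commute)
  also have "\<dots> = (real m + 1) ^ d * poly (h_polynomial \<Delta>) x"
    using arg_cong[OF poly_as_sum_of_monoms'[OF degree_h_polynomial_le[OF assms]], of "\<lambda>p. poly p x"]
    by (simp add: poly_sum poly_monom flip: sum_distrib_left)
  also have "\<dots> = (\<Sum>\<sigma>\<in>\<Delta>. (real m + 1) ^ d * (x ^ card \<sigma> * (1 - x) ^ (d - card \<sigma>)))"
    by (simp add: h_polynomial_eq_sum_faces[OF assms] poly_sum sum_distrib_left)
  also have "\<dots> = (\<Sum>\<sigma>\<in>\<Delta>. real m ^ card \<sigma>)"
  proof (rule sum.cong)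
    fix \<sigma> assume "\<sigma> \<in> \<Delta>"
    then have "card \<sigma> \<le> d"
      using assms Max_ge[of "card ` \<Delta>" "card \<sigma>"] by (simp add: complex_dim_def)
    moreover have "(real m + 1) * (1 - x) = 1" by (simp add: x_def field_simps)
    ultimately show "(real m + 1) ^ d * (x ^ card \<sigma> * (1 - x) ^ (d - card \<sigma>)) = real m ^ card \<sigma>"
      by (simp add: x)
  qed simp
  finally show ?thesis .
qed

text \<open>Each face of size c contributes x^c (1 - x)^(d-c), which is (1 - x)^(d+1) times the
  generating function x^c / (1 - x)^(c+1) of the binomial coefficients.\<close>

lemma fps_of_h_polynomial:
  assumes "finite \<Delta>" "complex_dim \<Delta> = int d - 1"
  shows "fps_of_poly (h_polynomial \<Delta>) = gf_numerator (d + 1) (\<lambda>m. \<Sum>\<sigma>\<in>\<Delta>. real (m choose card \<sigma>))"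
proof -
  have "fps_of_poly ([:0, 1:] ^ card \<sigma> * [:1, -1:] ^ (d - card \<sigma>)) =
      gf_numerator (d + 1) (\<lambda>m. real (m choose card \<sigma>))" if "\<sigma> \<in> \<Delta>" for \<sigma>
  proof -
    have "card \<sigma> \<le> d"
      using that assms Max_ge[of "card ` \<Delta>" "card \<sigma>"] by (simp add: complex_dim_def)
    then have "(1 - fps_X :: real fps) ^ (d + 1) = (1 - fps_X) ^ (d - card \<sigma>) * (1 - fps_X) ^ Suc (card \<sigma>)"
      by (simp flip: power_add)
    then have "gf_numerator (d + 1) (\<lambda>m. real (m choose card \<sigma>)) =
        (1 - fps_X) ^ (d - card \<sigma>) * gf_numerator (Suc (card \<sigma>)) (\<lambda>m. real (m choose card \<sigma>))"
      by (simp only: gf_numerator_def mult.assoc)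
    then show ?thesis
      by (simp add: gf_numerator_binomial fps_of_poly_mult fps_of_poly_power fps_of_poly_linear'
          mult.commute)
  qed
  then show ?thesis
    by (simp add: h_polynomial_eq_sum_faces[OF assms] fps_of_poly_sum gf_numerator_sum)
qed

lemma prod_all_W_is_transformation_matrix:
  "is_transformation_matrix barycentric_subdivision d
     (mat_prod_list (d + 1) (map (W d) [0..<2 * d]))"
  unfolding is_transformation_matrix_def
proof (intro conjI allI impI)
  let ?M = "mat_prod_list (d + 1) (map (W d) [0..<2 * d])"
  show M: "?M \<in> carrier_mat (d + 1) (d + 1)" unfolding prod_all_W by simp
  fix \<Delta> :: "'a set set"
  assume "abstract_simplicial_complex \<Delta> \<and> complex_dim \<Delta> = int d - 1"
  then have \<Delta>: "abstract_simplicial_complex \<Delta>" "finite \<Delta>" "complex_dim \<Delta> = int d - 1"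
    by (auto simp: abstract_simplicial_complex_def)
  note dim = complex_dim_barycentric_subdivision[OF \<Delta>(1,3)]
  let ?h = "h_polynomial \<Delta>"
  have "(?M *\<^sub>v h_vector \<Delta>) $ i = coeff (h_polynomial (barycentric_subdivision \<Delta>)) i"
    if "i < d + 1" for i
  proof -
    let ?s = "\<lambda>j m. real m ^ j * (real m + 1) ^ (d - j)"
    have "(?M *\<^sub>v h_vector \<Delta>) $ i = (\<Sum>j\<le>d. coeff ?h j * fps_nth (gf_numerator (d + 1) (?s j)) i)"
      using that \<Delta>(3) unfolding prod_all_W
      by (simp add: h_vector_def scalar_prod_def mult.commute atLeast0LessThan
          lessThan_Suc_atMost)
    also have "\<dots> = fps_nth (gf_numerator (d + 1) (\<lambda>m. \<Sum>j\<le>d. coeff ?h j * ?s j m)) i"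
      by (simp only: gf_numerator_sum gf_numerator_cmult fps_sum_nth fps_mult_left_const_nth)
    \<comment> \<open>The chain count enters here: both sequences equal the sum of m^|\<sigma>| over
      the faces of \<Delta>.\<close>
    also have "(\<lambda>m. \<Sum>j\<le>d. coeff ?h j * ?s j m) =
        (\<lambda>m. \<Sum>C\<in>barycentric_subdivision \<Delta>. real (m choose card C))"
      unfolding sum_coeff_h_polynomial[OF \<Delta>(2,3)]
      by (simp add: sum_choose_barycentric_subdivision[OF \<Delta>(1)] flip: of_nat_sum of_nat_power)
    finally show ?thesis
      unfolding fps_of_h_polynomial[OF barycentric_subdivision_finite(1)[OF \<Delta>(1)] dim, symmetric]
      by simp
  qed
  then show "h_vector (barycentric_subdivision \<Delta>) = ?M *\<^sub>v h_vector \<Delta>"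
    using M dim by (intro eq_vecI) (auto simp: h_vector_def)
qed

section \<open>Uniqueness of the transformation matrix\<close>

lemma h_polynomial_two_simplices:
  assumes "finite \<sigma>" "finite \<tau>" "\<sigma> \<inter> \<tau> = {}" "card \<tau> \<le> card \<sigma>"
  defines "\<Delta> \<equiv> Pow \<sigma> \<union> Pow \<tau>"
  shows "abstract_simplicial_complex \<Delta>" "complex_dim \<Delta> = int (card \<sigma>) - 1"
    "h_polynomial \<Delta> = 1 + [:1, -1:] ^ (card \<sigma> - card \<tau>) - [:1, -1:] ^ card \<sigma>"
proof -
  show "abstract_simplicial_complex \<Delta>"
    using assms by (auto simp: abstract_simplicial_complex_def intro: finite_subset)
  have fin: "finite \<Delta>" using assms by simp
  moreover have "\<Delta> \<noteq> {}" by (auto simp: \<Delta>_def)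
  moreover have "card \<rho> \<le> card \<sigma>" if "\<rho> \<in> \<Delta>" for \<rho>
    using that assms by (auto simp: \<Delta>_def intro: card_mono order_trans[OF card_mono])
  ultimately show dim: "complex_dim \<Delta> = int (card \<sigma>) - 1"
    by (subst complex_dim_eq_iff) (auto simp: \<Delta>_def)
  let ?g = "\<lambda>\<rho>. [:0, 1:] ^ card \<rho> * [:1, -1:] ^ (card \<sigma> - card \<rho>) :: real poly"
  have one: "[:0, 1:] + [:1, -1:] = (1 :: real poly)"
    by (simp add: one_pCons)
  \<comment> \<open>Inclusion-exclusion: the two simplices share only the empty face.\<close>
  have "h_polynomial \<Delta> = sum ?g (Pow \<sigma>) + sum ?g (Pow \<tau>) - sum ?g (Pow \<sigma> \<inter> Pow \<tau>)"
    unfolding h_polynomial_eq_sum_faces[OF fin dim] unfolding \<Delta>_def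
    using assms by (intro sum_Un) auto
  also have "Pow \<sigma> \<inter> Pow \<tau> = {{}}" using assms(3) by auto
  also have "sum ?g (Pow \<sigma>) = 1"
    using sum_Pow_power_card[OF assms(1), of "[:0, 1:] :: real poly" "[:1, -1:]"]
    by (simp only: one power_one mult_1)
  also have "sum ?g (Pow \<tau>) =
      (\<Sum>\<rho>\<in>Pow \<tau>. [:0, 1:] ^ card \<rho> * [:1, -1:] ^ (card \<tau> - card \<rho>)) * [:1, -1:] ^ (card \<sigma> - card \<tau>)"
    unfolding sum_distrib_right
  proof (rule sum.cong)
    fix \<rho> assume "\<rho> \<in> Pow \<tau>"
    then have "card \<rho> \<le> card \<tau>" using assms(2) by (auto intro: card_mono)
    then have "card \<sigma> - card \<rho> = (card \<tau> - card \<rho>) + (card \<sigma> - card \<tau>)" using assms(4) by simp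
    then show "?g \<rho> = [:0, 1:] ^ card \<rho> * [:1, -1:] ^ (card \<tau> - card \<rho>) * [:1, -1:] ^ (card \<sigma> - card \<tau>)"
      by (simp only: power_add mult.assoc)
  qed simp
  also have "\<dots> = [:1, -1:] ^ (card \<sigma> - card \<tau>)"
    using sum_Pow_power_card[OF assms(2), of "[:0, 1:] :: real poly" "[:1, -1:]"]
    by (simp only: one power_one mult_1)
  finally show "h_polynomial \<Delta> = 1 + [:1, -1:] ^ (card \<sigma> - card \<tau>) - [:1, -1:] ^ card \<sigma>"
    by simp
qed

text \<open>A linear functional killing all h-polynomials kills 1 (\<open>k = 0\<close>), then (1 -
  x)^d (\<open>k = d\<close>), then every (1 - x)^k with \<open>k \<le> d\<close>; these powers span
  the polynomials of degree at most d.\<close>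

lemma h_polynomials_span:
  fixes \<phi> :: "real poly \<Rightarrow> real"
  assumes add: "\<And>p q. \<phi> (p + q) = \<phi> p + \<phi> q"
    and smult: "\<And>c p. \<phi> (smult c p) = c * \<phi> p"
    and zero: "\<And>\<Delta> :: 'a :: infinite set set.
      abstract_simplicial_complex \<Delta> \<Longrightarrow> complex_dim \<Delta> = int d - 1 \<Longrightarrow> \<phi> (h_polynomial \<Delta>) = 0"
    and "j \<le> d"
  shows "\<phi> (monom 1 j) = 0"
proof -
  have sum: "\<phi> (\<Sum>k\<in>A. f k) = (\<Sum>k\<in>A. \<phi> (f k))" if "finite A" for f and A :: "nat set"
    using that
  proof induction
    case empty
    show ?case using smult[of 0 0] by simp
  qed (simp add: add)
  have diff: "\<phi> (p - q) = \<phi> p - \<phi> q" for p q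
    using add[of "p - q" q] by simp
  obtain \<sigma> :: "'a set" where \<sigma>: "finite \<sigma>" "card \<sigma> = d"
    using infinite_arbitrarily_large[OF infinite_UNIV] by blast
  have rel: "\<phi> 1 + \<phi> ([:1, -1:] ^ (d - k)) - \<phi> ([:1, -1:] ^ d) = 0" if "k \<le> d" for k
  proof -
    \<comment> \<open>An infinite vertex type leaves room for a second simplex disjoint from
      \<sigma>.\<close>
    have "infinite (UNIV - \<sigma>)" using \<sigma>(1) infinite_UNIV by (rule Diff_infinite_finite)
    then obtain \<tau> where \<tau>: "finite \<tau>" "card \<tau> = k" "\<tau> \<subseteq> UNIV - \<sigma>"
      using infinite_arbitrarily_large by blast
    have "\<sigma> \<inter> \<tau> = {}" "card \<tau> \<le> card \<sigma>" using \<tau> \<sigma> that by auto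
    note h = h_polynomial_two_simplices[OF \<sigma>(1) \<tau>(1) this]
    show ?thesis using zero[OF h(1)] h(2,3) by (simp add: \<sigma> \<tau> add diff)
  qed
  have "\<phi> 1 = 0" using rel[of 0] by simp
  moreover from this rel[of d] have "\<phi> ([:1, -1:] ^ d) = 0" by simp
  ultimately have pow: "\<phi> ([:1, -1:] ^ k) = 0" if "k \<le> d" for k
    using rel[of "d - k"] that by simp
  have binomial: "(smult (-1) p + 1) ^ j = (\<Sum>k\<le>j. smult (of_nat (j choose k) * (-1) ^ k) (p ^ k))"
    for p :: "real poly"
    unfolding binomial_ring smult_power by (simp add: of_nat_poly mult.commute)
  \<comment> \<open>Here x is written as 1 - (1 - x).\<close>
  have "monom 1 j = (smult (-1) [:1, -1:] + 1 :: real poly) ^ j"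
    by (simp add: monom_altdef one_pCons)
  also have "\<dots> = (\<Sum>k\<le>j. smult (of_nat (j choose k) * (-1) ^ k) ([:1, -1:] ^ k))"
    by (rule binomial)
  also have "\<phi> \<dots> = 0"
    using \<open>j \<le> d\<close> by (simp add: sum smult pow)
  finally show ?thesis .
qed

lemma is_transformation_matrix_unique:
  fixes F :: "'a :: infinite set set \<Rightarrow> 'b set set"
  assumes A: "is_transformation_matrix F d A" and B: "is_transformation_matrix F d B"
  shows "A = B"
proof -
  have dim: "A \<in> carrier_mat (d + 1) (d + 1)" "B \<in> carrier_mat (d + 1) (d + 1)"
    using A B by (auto simp: is_transformation_matrix_def)
  have "A $$ (i, j) = B $$ (i, j)" if i: "i < d + 1" and j: "j < d + 1" for i j
  proof -
    \<comment> \<open>Row \<open>i\<close> of A - B as a functional on coefficients: it vanishes on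
      h-polynomials and reads off the entry in column \<open>j\<close> from the monomial
      x^j.\<close>
    define \<phi> where "\<phi> p = (\<Sum>l\<le>d. (A $$ (i, l) - B $$ (i, l)) * coeff p l)" for p
    have "\<phi> (monom 1 j) = 0"
    proof (rule h_polynomials_span)
      show "\<phi> (p + q) = \<phi> p + \<phi> q" for p q
        by (simp add: \<phi>_def distrib_left sum.distrib)
      show "\<phi> (smult c p) = c * \<phi> p" for c p
        by (simp add: \<phi>_def sum_distrib_left mult.left_commute)
      show "\<phi> (h_polynomial \<Delta>) = 0"
        if \<Delta>: "abstract_simplicial_complex \<Delta>" "complex_dim \<Delta> = int d - 1" for \<Delta> :: "'a set set"
      proof -
        have "(A *\<^sub>v h_vector \<Delta>) $ i = (B *\<^sub>v h_vector \<Delta>) $ i"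
          using A B \<Delta> unfolding is_transformation_matrix_def by metis
        then show ?thesis
          using dim i \<Delta>(2)
          by (simp add: \<phi>_def h_vector_def scalar_prod_def atLeast0LessThan lessThan_Suc_atMost
              left_diff_distrib sum_subtractf)
      qed
      show "j \<le> d" using j by simp
    qed
    moreover have "\<phi> (monom 1 j) = A $$ (i, j) - B $$ (i, j)"
      using j by (simp add: \<phi>_def if_distrib[of "\<lambda>x. _ * x"] cong: if_cong)
    ultimately show ?thesis by simp
  qed
  then show ?thesis using dim by (intro eq_matI) auto
qed

theorem theorem3p2:
  fixes d :: nat
  assumes "d \<ge> 1"
  shows "transformation_matrix
           (barycentric_subdivision :: 'a::infinite set set \<Rightarrow> 'a set set set) d =
         mat_prod_list (d + 1) (map (W d) [0..<2 * d])"
  unfolding transformation_matrix_def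
  by (rule the_equality, rule prod_all_W_is_transformation_matrix)
    (rule is_transformation_matrix_unique, assumption, rule prod_all_W_is_transformation_matrix)

end
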